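(* Let $c>0$, $\omega\in\mathbb R$ with $\omega\neq0$, and consider the network $$\dot x_\ell=\mu x_\ell-\omega y_\ell-x_\ell(x_\ell^2+y_\ell^2)+c\sum_{k=1}^N a_{\ell k}(x_k-x_\ell),\qquad \dot y_\ell=\omega x_\ell+\mu y_\ell-y_\ell(x_\ell^2+y_\ell^2)+c\sum_{k=1}^N a_{\ell k}(y_k-y_\ell),$$ $\ell=1,\dots,N$, with parameter $\mu\in\mathbb R$ and all-to-all coupling, i.e. $a_{\ell k}=1$ for $k\ne\ell$ and $a_{\ell\ell}=0$ (the $s$-nearest-neighbor ring coupling with $s=\frac N2$ when $N$ is even and $s=\frac{N-1}{2}$ when $N$ is odd). Let $M_1,\dots,M_N$ be the $2\times2$ Fourier blocks of the Jacobian matrix at the origin. The block $M_1$ has eigenvalues $$\lambda_1^\pm(\mu)=\mu\pm\mathrm i\omega,$$ whereas each block $M_j$, $j=2,3,\dots,N$, has eigenvalues $$\lambda_j^\pm(\mu)=(\mu-Nc)\pm\mathrm i\omega.$$ Consequently, at $\mu=0$ only the block $M_1$ contributes a pair of purely imaginary eigenvalues $\pm\mathrm i\omega$; this corresponds to the supercritical Hopf bifurcation at $\mu=0$ of the dynamics on the synchronous manifold $\{x_1=\cdots=x_N,\ y_1=\cdots=y_N\}$. At $\mu=Nc$, all non-synchronous blocks $M_2,M_3,\dots,M_N$ become critical simultaneously. Each of these blocks has eigenvalues $\pm\mathrm i\omega$, so there are $N-1$ such pairs.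
   Context: Jacobian and Fourier blocks: with variables ordered $(x_1,y_1,\dots,x_N,y_N)$, the $2N\times2N$ Jacobian matrix at the origin is block-circulant with first block row $(A_1,A_2,\dots,A_N)$ (each subsequent block row is shifted cyclically one place to the right), where $A_1=\begin{bmatrix}\mu-(N-1)c&-\omega\\ \omega&\mu-(N-1)c\end{bmatrix}$ and $A_k=c\,I_2$ for $k=2,\dots,N$. Put $w=e^{-2\pi\mathrm i/N}$, $F_2=\frac1{\sqrt2}\begin{bmatrix}1&1\\1&-1\end{bmatrix}$, $B_{k-1}=F_2^*A_kF_2$, and $$M_j=\sum_{k=1}^N w^{(j-1)(k-1)}B_{k-1},\qquad j=1,\dots,N.$$ The Jacobian is unitarily similar to $\operatorname{diag}(M_1,\dots,M_N)$. The block $M_1$ corresponds to the synchronous mode, $M_2,\dots,M_N$ to non-synchronous modes. The dynamics on the synchronous manifold is $\dot x=\mu x-\omega y-x(x^2+y^2)$, $\dot y=\omega x+\mu y-y(x^2+y^2)$. A block is called critical at a given $\mu$ if its eigenvalues form a nonzero purely imaginary complex-conjugate pair. *)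

theory Defs
  imports "HOL-Analysis.Derivative" "Jordan_Normal_Form.Spectral_Radius"
begin

unbundle no vec_syntax

text \<open>Oscillators and Fourier modes are numbered \<open>1, \<dots>, N\<close>, while vector and matrix entries are
  numbered from \<open>0\<close>. A state \<open>(x\<^sub>1, y\<^sub>1, \<dots>, x\<^sub>N, y\<^sub>N)\<close> is a vector of dimension \<open>2N\<close>.\<close>

definition x_coord :: "real vec \<Rightarrow> nat \<Rightarrow> real" where
  "x_coord v l = vec_index v (2 * (l - 1))"

definition y_coord :: "real vec \<Rightarrow> nat \<Rightarrow> real" where
  "y_coord v l = vec_index v (2 * (l - 1) + 1)"

definition network_state :: "nat \<Rightarrow> (nat \<Rightarrow> real) \<Rightarrow> (nat \<Rightarrow> real) \<Rightarrow> real vec" where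
  "network_state N x y =
     vec (2 * N) (\<lambda>i. if even i then x (i div 2 + 1) else y (i div 2 + 1))"

definition network_field ::
  "nat \<Rightarrow> (nat \<Rightarrow> nat \<Rightarrow> real) \<Rightarrow> real \<Rightarrow> real \<Rightarrow> real \<Rightarrow> real vec \<Rightarrow> real vec" where
  "network_field N a c \<omega> \<mu> v = network_state N
     (\<lambda>l. \<mu> * x_coord v l - \<omega> * y_coord v l
            - x_coord v l * ((x_coord v l)\<^sup>2 + (y_coord v l)\<^sup>2)
            + c * (\<Sum>k=1..N. a l k * (x_coord v k - x_coord v l)))
     (\<lambda>l. \<omega> * x_coord v l + \<mu> * y_coord v l
            - y_coord v l * ((x_coord v l)\<^sup>2 + (y_coord v l)\<^sup>2)
            + c * (\<Sum>k=1..N. a l k * (y_coord v k - y_coord v l)))"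

definition ring_coupling :: "nat \<Rightarrow> nat \<Rightarrow> nat \<Rightarrow> nat \<Rightarrow> real" where
  "ring_coupling N s l k =
     (if \<exists>d\<in>{1..s}. (l + d) mod N = k mod N \<or> (k + d) mod N = l mod N then 1 else 0)"

definition jacobian :: "nat \<Rightarrow> (real vec \<Rightarrow> real vec) \<Rightarrow> real vec \<Rightarrow> real mat" where
  "jacobian n f v =
     mat n n (\<lambda>(p, q). deriv (\<lambda>t. vec_index (f (v + t \<cdot>\<^sub>v unit_vec n q)) p) 0)"

definition network_jacobian ::
  "nat \<Rightarrow> (nat \<Rightarrow> nat \<Rightarrow> real) \<Rightarrow> real \<Rightarrow> real \<Rightarrow> real \<Rightarrow> real mat" where
  "network_jacobian N a c \<omega> \<mu> = jacobian (2 * N) (network_field N a c \<omega> \<mu>) (0\<^sub>v (2 * N))"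

text \<open>For a block-circulant matrix \<open>J\<close>, the first block row \<open>(A\<^sub>1, \<dots>, A\<^sub>N)\<close> determines \<open>J\<close>, and
  the Fourier blocks are built from it.\<close>

definition first_row_block :: "real mat \<Rightarrow> nat \<Rightarrow> complex mat" where
  "first_row_block J k = mat 2 2 (\<lambda>(p, q). complex_of_real (J $$ (p, 2 * (k - 1) + q)))"

definition F2 :: "complex mat" where
  "F2 = complex_of_real (1 / sqrt 2) \<cdot>\<^sub>m mat_of_rows_list 2 [[1, 1], [1, -1]]"

definition fourier_block :: "nat \<Rightarrow> real mat \<Rightarrow> nat \<Rightarrow> complex mat" where
  "fourier_block N J j =
     (let w = exp (- 2 * complex_of_real pi * \<i> / of_nat N);
          B = (\<lambda>k. mat_adjoint F2 * first_row_block J (k + 1) * F2)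
      in mat 2 2 (\<lambda>(p, q). \<Sum>k=1..N. w ^ ((j - 1) * (k - 1)) * B (k - 1) $$ (p, q)))"

definition critical :: "complex mat \<Rightarrow> bool" where
  "critical M \<longleftrightarrow> (\<exists>\<beta>::real. \<beta> \<noteq> 0 \<and> spectrum M = {\<i> * of_real \<beta>, - \<i> * of_real \<beta>})"

definition sync_field :: "real \<Rightarrow> real \<Rightarrow> real \<times> real \<Rightarrow> real \<times> real" where
  "sync_field \<omega> \<mu> = (\<lambda>(x, y).
     (\<mu> * x - \<omega> * y - x * (x\<^sup>2 + y\<^sup>2), \<omega> * x + \<mu> * y - y * (x\<^sup>2 + y\<^sup>2)))"

definition sync_state :: "nat \<Rightarrow> real \<times> real \<Rightarrow> real vec" where
  "sync_state N z = network_state N (\<lambda>_. fst z) (\<lambda>_. snd z)"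

definition planar_jacobian :: "(real \<times> real \<Rightarrow> real \<times> real) \<Rightarrow> real \<times> real \<Rightarrow> complex mat" where
  "planar_jacobian f z = map_mat complex_of_real
     (jacobian 2 (\<lambda>v. vec_of_list [fst (f (vec_index v 0, vec_index v 1)),
                                     snd (f (vec_index v 0, vec_index v 1))])
        (vec_of_list [fst z, snd z]))"

definition solution_on ::
  "(real \<times> real \<Rightarrow> real \<times> real) \<Rightarrow> real set \<Rightarrow> (real \<Rightarrow> real \<times> real) \<Rightarrow> bool" where
  "solution_on f I u \<longleftrightarrow> (\<forall>t\<in>I. (u has_vector_derivative f (u t)) (at t within I))"

text \<open>Stability is required of solutions on every compact time interval \<open>[0,T]\<close>, so that solutions
  which escape in finite time are not ignored. For a compact \<open>K\<close> and a locally Lipschitz field it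
  then implies that solutions starting near \<open>K\<close> exist for all positive times.\<close>

definition stable_set :: "(real \<times> real \<Rightarrow> real \<times> real) \<Rightarrow> (real \<times> real) set \<Rightarrow> bool" where
  "stable_set f K \<longleftrightarrow> (\<forall>\<epsilon>>0. \<exists>\<delta>>0. \<forall>T\<ge>0. \<forall>u.
     solution_on f {0..T} u \<and> infdist (u 0) K < \<delta> \<longrightarrow> (\<forall>t\<in>{0..T}. infdist (u t) K < \<epsilon>))"

definition asymptotically_stable_set ::
  "(real \<times> real \<Rightarrow> real \<times> real) \<Rightarrow> (real \<times> real) set \<Rightarrow> bool" where
  "asymptotically_stable_set f K \<longleftrightarrow> stable_set f K \<and>
     (\<exists>\<delta>>0. \<forall>u. solution_on f {0..} u \<and> infdist (u 0) K < \<delta> \<longrightarrow>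
        ((\<lambda>t. infdist (u t) K) \<longlongrightarrow> 0) at_top)"

definition periodic_orbit ::
  "(real \<times> real \<Rightarrow> real \<times> real) \<Rightarrow> (real \<times> real) set \<Rightarrow> bool" where
  "periodic_orbit f C \<longleftrightarrow> (\<exists>u T. solution_on f UNIV u \<and> T > 0 \<and> (\<forall>t. u (t + T) = u t) \<and>
     (\<exists>t. u t \<noteq> u 0) \<and> C = range u)"

text \<open>Hopf bifurcation of the family \<open>F \<mu>\<close> at the equilibrium \<open>p\<close> and the parameter value \<open>\<mu>\<^sub>0\<close>: a
  complex-conjugate pair of eigenvalues crosses the imaginary axis from left to right with nonzero
  speed as \<open>\<mu>\<close> increases through \<open>\<mu>\<^sub>0\<close>. It is supercritical if \<open>p\<close> is asymptotically stable for
  \<open>\<mu> \<le> \<mu>\<^sub>0\<close> with no small periodic orbits, while for \<open>\<mu> > \<mu>\<^sub>0\<close> it is unstable and near it there is a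
  unique small periodic orbit, which is asymptotically stable and shrinks to \<open>p\<close> as
  \<open>\<mu>\<close> decreases to \<open>\<mu>\<^sub>0\<close>.\<close>

definition hopf_crossing ::
  "(real \<Rightarrow> real \<times> real \<Rightarrow> real \<times> real) \<Rightarrow> real \<times> real \<Rightarrow> real \<Rightarrow> bool" where
  "hopf_crossing F p \<mu>\<^sub>0 \<longleftrightarrow>
     (\<forall>\<^sub>F \<mu> in nhds \<mu>\<^sub>0. F \<mu> p = 0) \<and>
     (\<exists>\<alpha> \<beta>. (\<forall>\<^sub>F \<mu> in nhds \<mu>\<^sub>0. spectrum (planar_jacobian (F \<mu>) p) =
                 {Complex (\<alpha> \<mu>) (\<beta> \<mu>), Complex (\<alpha> \<mu>) (- \<beta> \<mu>)}) \<and>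
        isCont \<beta> \<mu>\<^sub>0 \<and> \<alpha> \<mu>\<^sub>0 = 0 \<and> \<beta> \<mu>\<^sub>0 \<noteq> 0 \<and>
        (\<exists>d>0. (\<alpha> has_real_derivative d) (at \<mu>\<^sub>0)))"

definition supercritical_hopf ::
  "(real \<Rightarrow> real \<times> real \<Rightarrow> real \<times> real) \<Rightarrow> real \<times> real \<Rightarrow> real \<Rightarrow> bool" where
  "supercritical_hopf F p \<mu>\<^sub>0 \<longleftrightarrow> hopf_crossing F p \<mu>\<^sub>0 \<and>
     (\<exists>r>0. \<exists>\<delta>>0.
        (\<forall>\<mu>\<in>{\<mu>\<^sub>0 - \<delta><..\<mu>\<^sub>0}. asymptotically_stable_set (F \<mu>) {p} \<and>
           (\<nexists>C. periodic_orbit (F \<mu>) C \<and> C \<subseteq> ball p r)) \<and>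
        (\<exists>C. (\<forall>\<mu>\<in>{\<mu>\<^sub>0<..<\<mu>\<^sub>0 + \<delta>}. \<not> stable_set (F \<mu>) {p} \<and>
                (\<forall>D. periodic_orbit (F \<mu>) D \<and> D \<subseteq> ball p r \<longleftrightarrow> D = C \<mu>) \<and>
                asymptotically_stable_set (F \<mu>) (C \<mu>)) \<and>
             (\<forall>\<epsilon>>0. \<forall>\<^sub>F \<mu> in at_right \<mu>\<^sub>0. C \<mu> \<subseteq> ball p \<epsilon>)))"

end

theory Submission
  imports Defs "HOL-Analysis.Complex_Transcendental"
begin

unbundle no vec_syntax

text \<open>
  For all-to-all coupling every block of the first block row of the Jacobian contains \<open>c I\<close>, and only
  the first one has an additional term, \<open>(\<mu> - N c) I\<close> plus the rotation generator times \<open>\<omega>\<close>. In the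
  Fourier sum for \<open>M\<^sub>j\<close> the additional term enters with weight \<open>1\<close>, whereas the common term is multiplied by a
  sum of powers of a root of unity, which is \<open>N\<close> for \<open>j = 1\<close> and \<open>0\<close> otherwise. Hence \<open>M\<^sub>1\<close> is
  \<open>\<mu> I\<close> plus a rotation part and \<open>M\<^sub>j\<close> is \<open>(\<mu> - N c) I\<close> plus the same rotation part for \<open>j \<ge> 2\<close>
  (\<open>fourier_block_all_to_all\<close>). The spectra \<open>\<mu> \<plusminus> \<i>\<omega>\<close> and \<open>(\<mu> - N c) \<plusminus> \<i>\<omega>\<close>
  and the values of \<open>\<mu>\<close> at which a block is critical can be read off.

  The bifurcation of the synchronous dynamics is obtained from its Lyapunov function. The squared radius satisfies
  \<open>V' = 2 V (\<mu> - V)\<close>, so \<open>W = (V - max \<mu> 0)\<^sup>2\<close> satisfies \<open>W' \<le> - 4 V W\<close> for \<open>\<mu>\<close> of either sign.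
  The attractor \<open>W = 0\<close> is the origin for \<open>\<mu> \<le> 0\<close> and the circle of radius \<open>sqrt \<mu>\<close> for \<open>\<mu> > 0\<close>;
  both are spheres, possibly degenerate, and one argument shows that they are asymptotically stable
  (\<open>asymptotically_stable_sphere\<close>). Periodicity makes \<open>W\<close> constant, which confines periodic orbits to the
  circle (\<open>periodic_orbit_sync_field_iff\<close>). Instability of the origin for \<open>\<mu> > 0\<close> is witnessed by an explicit spiral
  (\<open>unstable_origin\<close>).
\<close>

section \<open>Conformal two-by-two matrices\<close>

text \<open>The real matrix of multiplication by \<open>\<alpha> + \<i>\<beta>\<close>, over any commutative ring. The Jacobian blocks, their
  conjugates by \<^const>\<open>F2\<close> and the Fourier blocks all have this form, so they are determined by two numbers.\<close>

definition conformal_mat :: "'a::comm_ring_1 \<Rightarrow> 'a \<Rightarrow> 'a mat" where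
  "conformal_mat \<alpha> \<beta> = mat 2 2 (\<lambda>(p, q). if p = q then \<alpha> else if p < q then - \<beta> else \<beta>)"

lemma conformal_mat_carrier [simp]: "conformal_mat \<alpha> \<beta> \<in> carrier_mat 2 2"
  by (simp add: conformal_mat_def)

lemma eq_mat_2I:
  assumes "A \<in> carrier_mat 2 2" "B \<in> carrier_mat 2 2"
    and "A $$ (0, 0) = B $$ (0, 0)" "A $$ (0, 1) = B $$ (0, 1)"
    and "A $$ (1, 0) = B $$ (1, 0)" "A $$ (1, 1) = B $$ (1, 1)"
  shows "A = B"
proof (rule eq_matI)
  fix i j assume "i < dim_row B" "j < dim_col B"
  then have "i = 0 \<or> i = 1" "j = 0 \<or> j = 1" using assms(2) by auto
  then show "A $$ (i, j) = B $$ (i, j)" using assms(3-) by auto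
qed (use assms(1,2) in auto)

lemma index_mult_mat_2:
  assumes "A \<in> carrier_mat 2 2" "B \<in> carrier_mat 2 2" "i < 2" "j < 2"
  shows "(A * B) $$ (i, j) = A $$ (i, 0) * B $$ (0, j) + A $$ (i, 1) * B $$ (1, j)"
  using assms by (auto simp: scalar_prod_def numeral_2_eq_2)

lemma det_mat_2:
  assumes "A \<in> carrier_mat 2 2"
  shows "det A = A $$ (0, 0) * A $$ (1, 1) - A $$ (0, 1) * A $$ (1, 0)"
proof -
  have "det A = (\<Sum>j<2. A $$ (0, j) * cofactor A 0 j)"
    using laplace_expansion_row[OF assms, of 0] by simp
  also have "\<dots> = A $$ (0, 0) * A $$ (1, 1) - A $$ (0, 1) * A $$ (1, 0)"
    using assms by (simp add: numeral_2_eq_2 cofactor_def mat_delete_def det_single)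
  finally show ?thesis .
qed

lemma spectrum_conformal_mat:
  "spectrum (conformal_mat \<alpha> \<beta> :: complex mat) = {\<alpha> + \<i> * \<beta>, \<alpha> - \<i> * \<beta>}"
proof -
  have "eigenvalue (conformal_mat \<alpha> \<beta>) z \<longleftrightarrow> z = \<alpha> + \<i> * \<beta> \<or> z = \<alpha> - \<i> * \<beta>" for z :: complex
  proof -
    have "eigenvalue (conformal_mat \<alpha> \<beta>) z \<longleftrightarrow> det (char_matrix (conformal_mat \<alpha> \<beta>) z) = 0"
      by (rule eigenvalue_det[of _ 2]) simp
    also have "det (char_matrix (conformal_mat \<alpha> \<beta>) z) = (\<alpha> - z)\<^sup>2 + \<beta>\<^sup>2"
      by (subst det_mat_2) (auto simp: char_matrix_def conformal_mat_def power2_eq_square)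
    also have "(\<alpha> - z)\<^sup>2 + \<beta>\<^sup>2 = (z - (\<alpha> + \<i> * \<beta>)) * (z - (\<alpha> - \<i> * \<beta>))"
      by (simp add: algebra_simps power2_eq_square)
    finally show ?thesis by auto
  qed
  then show ?thesis by (auto simp: spectrum_def)
qed

text \<open>Conjugation by the symmetric involution \<^const>\<open>F2\<close> fixes the identity and reverses the rotation
  generator: \<^const>\<open>F2\<close> is a reflection of the plane, and a reflection reverses orientation.\<close>

lemma F2_conjugate_conformal_mat:
  "mat_adjoint F2 * conformal_mat \<alpha> \<beta> * F2 = conformal_mat \<alpha> (- \<beta>)"
proof -
  define h where "h = complex_of_real (1 / sqrt 2)"
  have F2: "F2 \<in> carrier_mat 2 2" "F2 $$ (0, 0) = h" "F2 $$ (0, 1) = h"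
    "F2 $$ (1, 0) = h" "F2 $$ (1, 1) = - h"
    by (auto simp: F2_def h_def mat_of_rows_list_def)
  have "h * h = complex_of_real (1 / sqrt 2 * (1 / sqrt 2))"
    unfolding h_def of_real_mult ..
  then have "h * h = 1 / 2" by simp
  then have hh: "h * h = 1 / 2" "h * (h * x) = x / 2" for x
    by (simp_all flip: mult.assoc)
  have "mat_adjoint F2 = F2"
    by (rule eq_mat_2I) (use F2 in \<open>auto simp: mat_adjoint_def mat_of_rows_def h_def\<close>)
  then show ?thesis
    using F2 by (intro eq_mat_2I)
      (auto simp del: index_mult_mat(1) One_nat_def
         simp: index_mult_mat_2 mult_carrier_mat[of _ 2 2 _ 2] conformal_mat_def algebra_simps hh)
qed

lemma critical_conformal_mat:
  assumes "\<omega> \<noteq> 0"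
  shows "critical (conformal_mat (of_real \<alpha>) (of_real \<omega>)) \<longleftrightarrow> \<alpha> = 0"
proof
  assume "critical (conformal_mat (of_real \<alpha>) (of_real \<omega>))"
  then obtain \<beta> :: real where
    "{complex_of_real \<alpha> + \<i> * of_real \<omega>, of_real \<alpha> - \<i> * of_real \<omega>} = {\<i> * of_real \<beta>, - \<i> * of_real \<beta>}"
    unfolding critical_def spectrum_conformal_mat by auto
  then have "complex_of_real \<alpha> + \<i> * of_real \<omega> \<in> {\<i> * of_real \<beta>, - \<i> * of_real \<beta>}" by blast
  then show "\<alpha> = 0" by (auto simp: complex_eq_iff)
next
  assume "\<alpha> = 0"
  then show "critical (conformal_mat (of_real \<alpha>) (of_real \<omega>))"
    unfolding critical_def spectrum_conformal_mat using assms by auto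
qed

text \<open>Exchanging the two coordinates is a reflection, so it reverses the sense of rotation.\<close>

lemma similar_conformal_mat_uminus:
  "similar_mat (conformal_mat \<alpha> (- \<beta>)) (conformal_mat \<alpha> \<beta>)"
proof -
  \<comment> \<open>The coordinate exchange, which is its own inverse.\<close>
  define P :: "'a mat" where "P = mat 2 2 (\<lambda>(p, q). if p = q then 0 else 1)"
  have P: "P \<in> carrier_mat 2 2" "P $$ (0, 0) = 0" "P $$ (0, 1) = 1" "P $$ (1, 0) = 1" "P $$ (1, 1) = 0"
    by (simp_all add: P_def)
  note idx = index_mult_mat_2 mult_carrier_mat[of _ 2 2 _ 2]
  have "P * P = 1\<^sub>m 2"
    using P by (intro eq_mat_2I) (auto simp del: One_nat_def index_mult_mat(1) simp: idx )
  moreover have "conformal_mat \<alpha> (- \<beta>) = P * conformal_mat \<alpha> \<beta> * P"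
    using P by (intro eq_mat_2I) (auto simp del: One_nat_def index_mult_mat(1) simp: idx conformal_mat_def)
  ultimately have "similar_mat_wit (conformal_mat \<alpha> (- \<beta>)) (conformal_mat \<alpha> \<beta>) P P"
    using P(1) by (simp add: similar_mat_wit_def Let_def) (auto simp: conformal_mat_def)
  then show ?thesis by (auto simp: similar_mat_def)
qed

section \<open>The Fourier blocks of the all-to-all network\<close>

text \<open>For \<open>j \<noteq> 1\<close> the weights run through the powers of an \<open>N\<close>-th root of unity \<open>z \<noteq> 1\<close>, and their geometric
  sum vanishes because \<open>z ^ N = 1\<close>.\<close>

lemma sum_fourier_weights:
  assumes "j \<in> {1..N}"
  shows "(\<Sum>k=1..N. exp (- 2 * complex_of_real pi * \<i> / of_nat N) ^ ((j - 1) * (k - 1)))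
    = (if j = 1 then of_nat N else 0)"
proof (cases "j = 1")
  case False
  define z where "z = exp (- 2 * complex_of_real pi * \<i> / of_nat N) ^ (j - 1)"
  have N: "0 < N" using assms by auto
  have z_exp: "z = exp (of_nat (j - 1) * (- 2 * complex_of_real pi * \<i> / of_nat N))"
    by (simp only: z_def exp_of_nat_mult)
  \<comment> \<open>\<open>z = 1\<close> would make \<open>(j - 1) / N\<close> an integer, but it lies strictly between \<open>0\<close> and \<open>1\<close>.\<close>
  have "z \<noteq> 1"
  proof
    assume "z = 1"
    then obtain n :: int where "real (j - 1) * (- 2 * pi / real N) = of_int (2 * n) * pi"
      by (auto simp: z_exp exp_eq_1)
    then have "(real (j - 1) * (- 2 * pi / real N)) * real N = (of_int (2 * n) * pi) * real N"
      by (rule arg_cong)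
    also have "(real (j - 1) * (- 2 * pi / real N)) * real N = - 2 * pi * real (j - 1)"
      using N by simp
    also have "(of_int (2 * n) * pi) * real N = - 2 * pi * (- real N * of_int n)"
      by (simp only: of_int_mult of_int_numeral mult_minus_left mult_minus_right minus_minus ac_simps)
    finally have "real (j - 1) = - real N * of_int n"
      by (subst (asm) mult_cancel_left) simp
    then have "real_of_int (int (j - 1)) = of_int (- int N * n)"
      by (simp only: of_int_mult of_int_minus of_int_of_nat_eq)
    then have "int (j - 1) = - int N * n" by (simp only: of_int_eq_iff)
    moreover have "int N dvd - int N * n" by simp
    ultimately have "int N dvd int (j - 1)" by (simp only:)
    then have "N dvd j - 1" by (simp only: int_dvd_int_iff)
    then have "N \<le> j - 1" using False assms by (intro dvd_imp_le) auto
    then show False using assms by auto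
  qed
  moreover have "z ^ N = 1"
  proof -
    have "exp (- 2 * complex_of_real pi * \<i> / of_nat N) ^ N
        = exp (of_nat N * (- 2 * complex_of_real pi * \<i> / of_nat N))"
      by (rule exp_of_nat_mult[symmetric])
    also have "\<dots> = 1" using N by (simp add: exp_minus)
    finally have "exp (- 2 * complex_of_real pi * \<i> / of_nat N) ^ N = 1" .
    moreover have "z ^ N = (exp (- 2 * complex_of_real pi * \<i> / of_nat N) ^ N) ^ (j - 1)"
      unfolding z_def by (simp only: power_mult[symmetric] mult.commute)
    ultimately show ?thesis by (simp only: power_one)
  qed
  moreover have "(\<Sum>k=1..N. exp (- 2 * complex_of_real pi * \<i> / of_nat N) ^ ((j - 1) * (k - 1)))
      = (\<Sum>k<N. z ^ k)"
    by (rule sum.reindex_bij_witness[of _ Suc "\<lambda>k. k - 1"]) (auto simp: z_def power_mult)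
  ultimately show ?thesis using False by (simp add: sum_gp_strict)
qed simp

lemma coord_unit_vec:
  assumes "l \<in> {1..N}"
  shows "x_coord (0\<^sub>v (2 * N) + t \<cdot>\<^sub>v unit_vec (2 * N) q) l = of_bool (q = 2 * (l - 1)) * t"
    and "y_coord (0\<^sub>v (2 * N) + t \<cdot>\<^sub>v unit_vec (2 * N) q) l = of_bool (q = 2 * (l - 1) + 1) * t"
  using assms by (auto simp: x_coord_def y_coord_def unit_vec_def)

text \<open>The cubic terms have zero derivative at the origin. The all-to-all coupling acts on the first oscillator as
  \<open>\<Sum>\<^sub>k x\<^sub>k - N x\<^sub>1\<close>; its first part puts \<open>c\<close> on the diagonal of every block, the first one included,
  so the first block differs from the others by \<open>\<mu> - N c\<close> and the rotation \<open>\<omega>\<close>. In this form the Fourier sum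
  separates into a constant part and a part supported at \<open>k = 1\<close>.\<close>

lemma network_jacobian_first_row:
  assumes all_to_all: "\<And>l k. l \<in> {1..N} \<Longrightarrow> k \<in> {1..N} \<Longrightarrow> a l k = (if k = l then 0 else 1)"
    and k: "k \<in> {1..N}"
  shows "first_row_block (network_jacobian N a c \<omega> \<mu>) k =
    conformal_mat (of_real (c + (if k = 1 then \<mu> - real N * c else 0)))
      (of_real (if k = 1 then \<omega> else 0))"
proof -
  have N: "N \<ge> 1" using k by auto
  have coupling: "(\<Sum>k=1..N. a 1 k * (g k - g 1)) = (\<Sum>k=1..N. g k) - real N * g 1" for g
  proof -
    have "(\<Sum>k=1..N. a 1 k * (g k - g 1)) = (\<Sum>k=1..N. g k - g 1)"
      using N by (intro sum.cong) (auto simp: all_to_all)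
    then show ?thesis by (simp add: sum_subtractf)
  qed
  \<comment> \<open>Both components of the field along a coordinate axis have this form.\<close>
  have d: "deriv (\<lambda>t. \<alpha> * t - \<beta> * t - \<gamma> * t * ((\<alpha>' * t)\<^sup>2 + (\<beta>' * t)\<^sup>2) + c * (\<kappa> * t)) 0
      = \<alpha> - \<beta> + c * \<kappa>" for \<alpha> \<beta> \<gamma> \<alpha>' \<beta>' \<kappa> :: real
    by (rule DERIV_imp_deriv) (auto intro!: derivative_eq_intros)
  \<comment> \<open>The oscillator coordinates of the \<open>q\<close>-th unit vector.\<close>
  define X where "X q l = (of_bool (q = 2 * (l - 1)) :: real)" for q l :: nat
  define Y where "Y q l = (of_bool (q = 2 * (l - 1) + 1) :: real)" for q l :: nat
  have row: "network_jacobian N a c \<omega> \<mu> $$ (0, q)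
        = \<mu> * X q 1 - \<omega> * Y q 1 + c * ((\<Sum>k=1..N. X q k) - real N * X q 1)"
    "network_jacobian N a c \<omega> \<mu> $$ (1, q)
        = \<omega> * X q 1 + \<mu> * Y q 1 + c * ((\<Sum>k=1..N. Y q k) - real N * Y q 1)"
    if q: "q < 2 * N" for q
  proof -
    define v where "v t = 0\<^sub>v (2 * N) + t \<cdot>\<^sub>v unit_vec (2 * N) q" for t :: real
    have xy: "x_coord (v t) l = X q l * t" "y_coord (v t) l = Y q l * t" if "l \<in> {1..N}" for t l
      using that unfolding v_def X_def Y_def by (rule coord_unit_vec)+
    have J: "network_jacobian N a c \<omega> \<mu> $$ (p, q)
        = deriv (\<lambda>t. vec_index (network_field N a c \<omega> \<mu> (v t)) p) 0" if "p < 2" for p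
    proof -
      have "p < 2 * N" using that N by linarith
      then show ?thesis using q by (simp add: network_jacobian_def jacobian_def v_def)
    qed
    have s: "(\<Sum>k=1..N. x_coord (v t) k) = (\<Sum>k=1..N. X q k) * t"
      "(\<Sum>k=1..N. y_coord (v t) k) = (\<Sum>k=1..N. Y q k) * t" for t
      unfolding sum_distrib_right by (intro sum.cong refl xy; simp)+
    have 1: "1 \<in> {1..N}" using N by simp
    have cpl: "(\<Sum>k=1..N. a 1 k * (x_coord (v t) k - x_coord (v t) 1))
        = ((\<Sum>k=1..N. X q k) - real N * X q 1) * t"
      "(\<Sum>k=1..N. a 1 k * (y_coord (v t) k - y_coord (v t) 1))
        = ((\<Sum>k=1..N. Y q k) - real N * Y q 1) * t" for t
      by (simp_all only: coupling s) (simp_all only: xy[OF 1] left_diff_distrib mult.assoc)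
    have f0: "vec_index (network_field N a c \<omega> \<mu> (v t)) 0
      = \<mu> * X q 1 * t - \<omega> * Y q 1 * t - X q 1 * t * ((X q 1 * t)\<^sup>2 + (Y q 1 * t)\<^sup>2)
        + c * (((\<Sum>k=1..N. X q k) - real N * X q 1) * t)" for t
      using N by (simp add: network_field_def network_state_def cpl[unfolded xy[OF 1]] xy[OF 1] mult.assoc
          del: One_nat_def sum.cl_ivl_Suc)
    have f1: "vec_index (network_field N a c \<omega> \<mu> (v t)) 1
      = \<mu> * Y q 1 * t - (- \<omega> * X q 1) * t - Y q 1 * t * ((X q 1 * t)\<^sup>2 + (Y q 1 * t)\<^sup>2)
        + c * (((\<Sum>k=1..N. Y q k) - real N * Y q 1) * t)" for t
      using N by (simp add: network_field_def network_state_def cpl[unfolded xy[OF 1]] xy[OF 1] mult.assoc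
          del: One_nat_def sum.cl_ivl_Suc)
    show "network_jacobian N a c \<omega> \<mu> $$ (0, q)
        = \<mu> * X q 1 - \<omega> * Y q 1 + c * ((\<Sum>k=1..N. X q k) - real N * X q 1)"
      by (simp only: J zero_less_numeral f0 d)
    show "network_jacobian N a c \<omega> \<mu> $$ (1, q)
        = \<omega> * X q 1 + \<mu> * Y q 1 + c * ((\<Sum>k=1..N. Y q k) - real N * Y q 1)"
    proof -
      have "network_jacobian N a c \<omega> \<mu> $$ (1, q)
          = deriv (\<lambda>t. vec_index (network_field N a c \<omega> \<mu> (v t)) 1) 0"
        by (rule J) simp
      also have "\<dots> = \<mu> * Y q 1 - (- \<omega> * X q 1) + c * ((\<Sum>k=1..N. Y q k) - real N * Y q 1)"
        unfolding f1 by (rule d)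
      finally show ?thesis by simp
    qed
  qed
  have X: "X (2 * (k - 1)) l = of_bool (l = k)" "X (2 * (k - 1) + 1) l = 0"
    and Y: "Y (2 * (k - 1)) l = 0" "Y (2 * (k - 1) + 1) l = of_bool (l = k)" if "l \<in> {1..N}" for l
    using that k unfolding X_def Y_def by (auto; presburger)+
  have sums: "(\<Sum>l=1..N. X (2 * (k - 1)) l) = 1" "(\<Sum>l=1..N. X (2 * (k - 1) + 1) l) = 0"
    "(\<Sum>l=1..N. Y (2 * (k - 1)) l) = 0" "(\<Sum>l=1..N. Y (2 * (k - 1) + 1) l) = 1"
  proof -
    have one: "(\<Sum>l=1..N. of_bool (l = k) :: real) = 1"
      using k by (simp add: of_bool_def)
    show "(\<Sum>l=1..N. X (2 * (k - 1)) l) = 1" "(\<Sum>l=1..N. Y (2 * (k - 1) + 1) l) = 1"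
      unfolding one[symmetric] by (intro sum.cong refl X Y; assumption)+
    show "(\<Sum>l=1..N. X (2 * (k - 1) + 1) l) = 0" "(\<Sum>l=1..N. Y (2 * (k - 1)) l) = 0"
      by (intro sum.neutral ballI X Y; assumption)+
  qed
  have 1: "1 \<in> {1..N}" using N by simp
  have q: "2 * (k - 1) < 2 * N" "2 * (k - 1) + 1 < 2 * N" using k by auto
  let ?J = "network_jacobian N a c \<omega> \<mu>"
  have entries: "?J $$ (0, 2 * (k - 1)) = c + (if k = 1 then \<mu> - real N * c else 0)"
    "?J $$ (0, 2 * (k - 1) + 1) = - (if k = 1 then \<omega> else 0)"
    "?J $$ (1, 2 * (k - 1)) = (if k = 1 then \<omega> else 0)"
    "?J $$ (1, 2 * (k - 1) + 1) = c + (if k = 1 then \<mu> - real N * c else 0)"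
    unfolding row(1)[OF q(1)] row(2)[OF q(1)] row(1)[OF q(2)] row(2)[OF q(2)]
      sums X[OF 1] Y[OF 1]
    by (cases "k = 1"; simp add: algebra_simps)+
  show ?thesis
    by (rule eq_mat_2I)
      (simp_all add: first_row_block_def conformal_mat_def entries del: One_nat_def)
qed

text \<open>The constant part \<open>c I\<close> of the first block row is summed against the Fourier weights, which gives \<open>N c\<close> for
  \<open>j = 1\<close> and \<open>0\<close> otherwise; the part supported at \<open>k = 1\<close> has weight \<open>1\<close> in every mode. The sign of
  \<open>\<omega>\<close> comes from the conjugation by \<^const>\<open>F2\<close>.\<close>

lemma fourier_block_all_to_all:
  assumes all_to_all: "\<And>l k. l \<in> {1..N} \<Longrightarrow> k \<in> {1..N} \<Longrightarrow> a l k = (if k = l then 0 else 1)"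
    and j: "j \<in> {1..N}"
  shows "fourier_block N (network_jacobian N a c \<omega> \<mu>) j =
    conformal_mat (of_real (if j = 1 then \<mu> else \<mu> - real N * c)) (- of_real \<omega>)"
proof -
  define w where "w = exp (- 2 * complex_of_real pi * \<i> / of_nat N)"
  define B where "B = (\<lambda>k. mat_adjoint F2 * first_row_block (network_jacobian N a c \<omega> \<mu>) (k + 1) * F2)"
  have B: "B (k - 1) = conformal_mat (of_real c + of_real (if k = 1 then \<mu> - real N * c else 0))
      (- of_real (if k = 1 then \<omega> else 0))" if "k \<in> {1..N}" for k
    using that network_jacobian_first_row[where a = a, OF all_to_all that, of c \<omega> \<mu>]
    by (simp add: B_def F2_conjugate_conformal_mat)
  have fb: "fourier_block N (network_jacobian N a c \<omega> \<mu>) j = 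
    mat 2 2 (\<lambda>(p, q). \<Sum>k=1..N. w ^ ((j - 1) * (k - 1)) * B (k - 1) $$ (p, q))"
    by (simp add: fourier_block_def w_def B_def Let_def)
  have sumw: "(\<Sum>k=1..N. w ^ ((j - 1) * (k - 1))) = (if j = 1 then of_nat N else 0)"
    unfolding w_def by (rule sum_fourier_weights[OF j])
  have sum_first: "(\<Sum>k=1..N. w ^ ((j - 1) * (k - 1)) * of_real (if k = 1 then r else 0)) = of_real r" for r
  proof -
    have "(\<Sum>k=1..N. w ^ ((j - 1) * (k - 1)) * of_real (if k = 1 then r else 0))
      = (\<Sum>k=1..N. if k = 1 then of_real r else 0)"
      by (intro sum.cong) auto
    then show ?thesis using j by simp
  qed
  have diag: "(\<Sum>k=1..N. w ^ ((j - 1) * (k - 1)) * B (k - 1) $$ (p, p))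
      = of_real (if j = 1 then \<mu> else \<mu> - real N * c)" if "p < 2" for p
  proof -
    have "(\<Sum>k=1..N. w ^ ((j - 1) * (k - 1)) * B (k - 1) $$ (p, p))
      = (\<Sum>k=1..N. w ^ ((j - 1) * (k - 1)) * of_real c
         + w ^ ((j - 1) * (k - 1)) * of_real (if k = 1 then \<mu> - real N * c else 0))"
      using that by (intro sum.cong) (simp_all add: B conformal_mat_def distrib_left del: One_nat_def)
    then show ?thesis
      by (simp only: sum.distrib sum_first sumw sum_distrib_right[symmetric]) simp
  qed
  have off: "(\<Sum>k=1..N. w ^ ((j - 1) * (k - 1)) * B (k - 1) $$ (0, 1)) = of_real \<omega>"
    "(\<Sum>k=1..N. w ^ ((j - 1) * (k - 1)) * B (k - 1) $$ (1, 0)) = - of_real \<omega>"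
  proof -
    have "(\<Sum>k=1..N. w ^ ((j - 1) * (k - 1)) * B (k - 1) $$ (0, 1))
      = (\<Sum>k=1..N. w ^ ((j - 1) * (k - 1)) * of_real (if k = 1 then \<omega> else 0))"
      by (intro sum.cong) (simp_all add: B conformal_mat_def del: One_nat_def)
    then show "(\<Sum>k=1..N. w ^ ((j - 1) * (k - 1)) * B (k - 1) $$ (0, 1)) = of_real \<omega>"
      by (simp only: sum_first)
    have "(\<Sum>k=1..N. w ^ ((j - 1) * (k - 1)) * B (k - 1) $$ (1, 0))
      = (\<Sum>k=1..N. w ^ ((j - 1) * (k - 1)) * of_real (if k = 1 then - \<omega> else 0))"
      by (intro sum.cong) (simp_all add: B conformal_mat_def del: One_nat_def)
    then show "(\<Sum>k=1..N. w ^ ((j - 1) * (k - 1)) * B (k - 1) $$ (1, 0)) = - of_real \<omega>"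
      by (simp only: sum_first of_real_minus)
  qed
  show ?thesis
    unfolding fb by (rule eq_mat_2I) (use diag off in \<open>simp_all add: conformal_mat_def\<close>)
qed

text \<open>Two distinct oscillators at distance \<open>d\<close> along the ring in one direction are at distance \<open>N - d\<close> in the other,
  and the smaller of the two is at most \<open>N div 2\<close>, which is the range \<open>s\<close> for either parity of \<open>N\<close>. An
  oscillator is not coupled to itself because \<open>s < N\<close>.\<close>

lemma ring_coupling_all_to_all:
  assumes l: "l \<in> {1..N}" and k: "k \<in> {1..N}"
  shows "ring_coupling N (if even N then N div 2 else (N - 1) div 2) l k = (if k = l then 0 else 1)"
proof -
  define s where "s = (if even N then N div 2 else (N - 1) div 2)"
  have s: "s = N div 2" by (auto simp: s_def elim!: oddE)
  have shift: "\<exists>d\<in>{1..s}. (p + d) mod N = q mod N \<or> (q + d) mod N = p mod N"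
    if "p < q" "q \<le> N" "1 \<le> p" for p q
  proof (cases "q - p \<le> s")
    case True
    then have "q - p \<in> {1..s}" "(p + (q - p)) mod N = q mod N" using that by auto
    then show ?thesis by blast
  next
    case False
    then have "N - (q - p) \<in> {1..s}" using that by (auto simp: s)
    moreover have "(q + (N - (q - p))) mod N = p mod N"
    proof -
      have "q + (N - (q - p)) = p + N" using that by auto
      then show ?thesis by simp
    qed
    ultimately show ?thesis by blast
  qed
  have "(l + d) mod N \<noteq> l mod N" if "d \<in> {1..s}" for d
  proof
    assume "(l + d) mod N = l mod N"
    then have "N dvd d" by (metis add_diff_cancel_left' le_add1 mod_eq_dvd_iff_nat)
    then have "N \<le> d" using that by (intro dvd_imp_le) auto
    then show False using that l by (auto simp: s)
  qed
  then show ?thesis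
    using shift[of l k] shift[of k l] l k
    unfolding ring_coupling_def s_def[symmetric] by (cases l k rule: linorder_cases) auto
qed

text \<open>All coupling terms vanish on the synchronous manifold.\<close>

lemma network_field_sync_state:
  "network_field N a c \<omega> \<mu> (sync_state N z) = sync_state N (sync_field \<omega> \<mu> z)"
proof -
  have xy: "x_coord (sync_state N z) l = fst z" "y_coord (sync_state N z) l = snd z"
    if "l \<in> {1..N}" for l
    using that by (auto simp: x_coord_def y_coord_def sync_state_def network_state_def)
  show ?thesis
    unfolding network_field_def
    by (subst (5) sync_state_def, unfold network_state_def, rule eq_vecI)
       (auto simp: xy sync_field_def split: prod.split)
qed
section \<open>Distance to a sphere and decay of a Lyapunov function\<close>

text \<open>The nearest point of the sphere lies on the ray through \<open>z\<close>; for \<open>z = 0\<close> every point of the sphere is nearest.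
  The case \<open>\<rho> = 0\<close>, where the sphere is a single point, is included so that the two sides of the bifurcation can be
  treated together.\<close>

lemma infdist_sphere_0:
  fixes z :: "'a::euclidean_space"
  assumes "0 \<le> \<rho>"
  shows "infdist z (sphere 0 \<rho>) = \<bar>norm z - \<rho>\<bar>"
proof (rule antisym)
  obtain w where w: "norm w = \<rho>" "dist z w = \<bar>norm z - \<rho>\<bar>"
  proof (cases "z = 0")
    case True
    obtain w :: 'a where "norm w = \<rho>" using vector_choose_size[OF assms] by blast
    then show ?thesis using True assms by (intro that[of w]) auto
  next
    case False
    have "dist z ((\<rho> / norm z) *\<^sub>R z) = norm ((1 - \<rho> / norm z) *\<^sub>R z)"
      by (simp add: dist_norm scaleR_diff_left)
    also have "\<dots> = \<bar>(1 - \<rho> / norm z) * norm z\<bar>" by (simp add: abs_mult)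
    also have "(1 - \<rho> / norm z) * norm z = norm z - \<rho>" using False by (simp add: field_simps)
    finally show ?thesis using False assms by (intro that[of "(\<rho> / norm z) *\<^sub>R z"]) auto
  qed
  then show "infdist z (sphere 0 \<rho>) \<le> \<bar>norm z - \<rho>\<bar>"
    using infdist_le[of w "sphere 0 \<rho>" z] by simp
  have "sphere (0::'a) \<rho> \<noteq> {}" using w by auto
  moreover have "\<bar>norm z - \<rho>\<bar> \<le> dist z v" if "v \<in> sphere 0 \<rho>" for v
    using that norm_triangle_ineq3[of z v] by (simp add: dist_norm)
  ultimately show "\<bar>norm z - \<rho>\<bar> \<le> infdist z (sphere 0 \<rho>)"
    unfolding infdist_def by (auto intro!: cINF_greatest)
qed

lemma decrease_by_derivative_bound:
  fixes W W' :: "real \<Rightarrow> real"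
  assumes "a \<le> b" "{a..b} \<subseteq> I"
    and "\<And>t. t \<in> I \<Longrightarrow> (W has_real_derivative W' t) (at t within I)"
    and "\<And>t. t \<in> {a..b} \<Longrightarrow> W' t \<le> - k"
  shows "W b \<le> W a - k * (b - a)"
proof -
  have "\<forall>t\<in>{a..b}. (W has_derivative (*) (W' t)) (at t within {a..b})"
    using assms(2,3) by (meson has_field_derivative_def has_derivative_subset subsetD)
  from mvt_very_simple[OF assms(1), of W "\<lambda>t. (*) (W' t)"] this
  obtain t where "t \<in> {a..b}" "W b - W a = W' t * (b - a)" by auto
  moreover have "W' t * (b - a) \<le> - k * (b - a)"
    using assms(1,4) \<open>t \<in> {a..b}\<close> by (intro mult_right_mono) auto
  ultimately show ?thesis by linarith
qed

text \<open>As long as the decreasing function \<open>W\<close> stays above \<open>e\<close> it falls with speed at least \<open>k\<close>, so it would become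
  negative by time \<open>(W 0 + 1) / k\<close>. The decay rate may depend on the level \<open>e\<close>, which matters at \<open>\<mu> = 0\<close>, where
  convergence is only algebraic.\<close>

lemma tendsto_0_of_strict_decay:
  fixes W W' :: "real \<Rightarrow> real"
  assumes deriv: "\<And>t. t \<ge> 0 \<Longrightarrow> (W has_real_derivative W' t) (at t within {0..})"
    and nonpos: "\<And>t. t \<ge> 0 \<Longrightarrow> W' t \<le> 0"
    and nonneg: "\<And>t. t \<ge> 0 \<Longrightarrow> W t \<ge> 0"
    and decay: "\<And>e. e > 0 \<Longrightarrow> \<exists>k>0. \<forall>t\<ge>0. W t \<ge> e \<longrightarrow> W' t \<le> - k"
  shows "(W \<longlongrightarrow> 0) at_top"
proof (rule tendstoI)
  fix e :: real assume "e > 0"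
  then obtain k where k: "k > 0" "\<And>t. t \<ge> 0 \<Longrightarrow> W t \<ge> e \<Longrightarrow> W' t \<le> - k" using decay by blast
  define T where "T = (W 0 + 1) / k"
  have T: "T \<ge> 0" using k(1) nonneg[of 0] by (simp add: T_def)
  have mono: "W t \<le> W s" if "0 \<le> s" "s \<le> t" for s t
    using decrease_by_derivative_bound[of s t "{0..}" W W' 0] that deriv nonpos by auto
  have "W T < e"
  proof (rule ccontr)
    assume "\<not> W T < e"
    then have "W t \<ge> e" if "t \<in> {0..T}" for t using mono[of t T] that by auto
    then have "W T \<le> W 0 - k * (T - 0)"
      using T deriv k(2) by (intro decrease_by_derivative_bound[of 0 T "{0..}" W W' k]) auto
    then have "W T \<le> -1" using k(1) by (simp add: T_def)
    then show False using nonneg[OF T] by linarith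
  qed
  then have "dist (W t) 0 < e" if "t \<ge> T" for t
    using mono[of T t] nonneg[of t] T that by auto
  then show "\<forall>\<^sub>F t in at_top. dist (W t) 0 < e" by (auto simp: eventually_at_top_linorder)
qed

section \<open>A Lyapunov function for the synchronous dynamics\<close>

lemma norm_square_pair: "(norm z)\<^sup>2 = (fst z)\<^sup>2 + (snd z)\<^sup>2" for z :: "real \<times> real"
  by (simp add: norm_prod_def)

lemma solution_on_sync_field_components:
  assumes "solution_on (sync_field \<omega> \<mu>) I u" "t \<in> I"
  shows "((\<lambda>t. fst (u t)) has_real_derivative
           \<mu> * fst (u t) - \<omega> * snd (u t) - fst (u t) * (norm (u t))\<^sup>2) (at t within I)"
    and "((\<lambda>t. snd (u t)) has_real_derivative
           \<omega> * fst (u t) + \<mu> * snd (u t) - snd (u t) * (norm (u t))\<^sup>2) (at t within I)"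
proof -
  have *: "(u has_vector_derivative sync_field \<omega> \<mu> (u t)) (at t within I)"
    using assms by (auto simp: solution_on_def)
  show "((\<lambda>t. fst (u t)) has_real_derivative
           \<mu> * fst (u t) - \<omega> * snd (u t) - fst (u t) * (norm (u t))\<^sup>2) (at t within I)"
    using bounded_linear.has_vector_derivative[OF bounded_linear_fst *]
    by (simp add: has_real_derivative_iff_has_vector_derivative sync_field_def norm_square_pair
        case_prod_beta)
  show "((\<lambda>t. snd (u t)) has_real_derivative
           \<omega> * fst (u t) + \<mu> * snd (u t) - snd (u t) * (norm (u t))\<^sup>2) (at t within I)"
    using bounded_linear.has_vector_derivative[OF bounded_linear_snd *]
    by (simp add: has_real_derivative_iff_has_vector_derivative sync_field_def norm_square_pair
        case_prod_beta)
qed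

lemma solution_onI_components:
  assumes "\<And>t. t \<in> I \<Longrightarrow> (x has_real_derivative fst (f (x t, y t))) (at t within I)"
    and "\<And>t. t \<in> I \<Longrightarrow> (y has_real_derivative snd (f (x t, y t))) (at t within I)"
  shows "solution_on f I (\<lambda>t. (x t, y t))"
  unfolding solution_on_def
proof
  fix t assume t: "t \<in> I"
  show "((\<lambda>t. (x t, y t)) has_vector_derivative f (x t, y t)) (at t within I)"
    using has_vector_derivative_Pair[OF
        assms(1)[OF t, unfolded has_real_derivative_iff_has_vector_derivative]
        assms(2)[OF t, unfolded has_real_derivative_iff_has_vector_derivative]] by simp
qed

text \<open>A Lyapunov function for all \<open>\<mu>\<close> at once: \<open>max \<mu> 0\<close> is the squared radius of the attractor, which is the origin
  for \<open>\<mu> \<le> 0\<close> and the circle of radius \<open>sqrt \<mu>\<close> for \<open>\<mu> > 0\<close>.\<close>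

definition energy_defect :: "real \<Rightarrow> real \<times> real \<Rightarrow> real" where
  "energy_defect \<mu> z = ((norm z)\<^sup>2 - max \<mu> 0)\<^sup>2"

text \<open>The derivative of \<^const>\<open>energy_defect\<close> along the flow, from \<open>V' = 2 V (\<mu> - V)\<close> for the squared radius \<open>V\<close>.\<close>

definition energy_defect_rate :: "real \<Rightarrow> real \<times> real \<Rightarrow> real" where
  "energy_defect_rate \<mu> z = 4 * (norm z)\<^sup>2 * ((norm z)\<^sup>2 - max \<mu> 0) * (\<mu> - (norm z)\<^sup>2)"

lemma energy_defect_derivative:
  assumes "solution_on (sync_field \<omega> \<mu>) I u" "t \<in> I"
  shows "((\<lambda>t. energy_defect \<mu> (u t)) has_real_derivative energy_defect_rate \<mu> (u t)) (at t within I)"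
proof -
  note d = solution_on_sync_field_components[OF assms]
  have "((\<lambda>t. (norm (u t))\<^sup>2) has_real_derivative 2 * (norm (u t))\<^sup>2 * (\<mu> - (norm (u t))\<^sup>2)) (at t within I)"
    unfolding norm_square_pair
    by (rule derivative_eq_intros d[unfolded norm_square_pair] refl)+ (simp add: algebra_simps power2_eq_square)
  note V = this
  show ?thesis
    unfolding energy_defect_def energy_defect_rate_def
    by (rule derivative_eq_intros V refl)+ (simp add: algebra_simps)
qed

text \<open>For \<open>\<mu> \<ge> 0\<close> this is an equality. For \<open>\<mu> < 0\<close> the rate is \<open>4 V\<^sup>2 (\<mu> - V)\<close>, and the nonpositive term \<open>4 V\<^sup>2 \<mu>\<close>
  is dropped.\<close>

lemma energy_defect_rate_le: "energy_defect_rate \<mu> z \<le> - 4 * (norm z)\<^sup>2 * energy_defect \<mu> z"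
proof (cases "\<mu> \<ge> 0")
  case True
  then show ?thesis
    by (simp add: energy_defect_rate_def energy_defect_def power2_eq_square algebra_simps)
next
  case False
  define V where "V = (norm z)\<^sup>2"
  have "4 * V * V * \<mu> \<le> 0" using False by (simp add: mult_nonneg_nonpos)
  then show ?thesis using False unfolding energy_defect_rate_def energy_defect_def V_def[symmetric]
    by (simp add: power2_eq_square algebra_simps)
qed

lemma energy_defect_rate_nonpos: "energy_defect_rate \<mu> z \<le> 0"
  by (rule order_trans[OF energy_defect_rate_le]) (simp add: energy_defect_def)

lemma energy_defect_antimono:
  assumes "solution_on (sync_field \<omega> \<mu>) I u" "{s..t} \<subseteq> I" "s \<le> t"
  shows "energy_defect \<mu> (u t) \<le> energy_defect \<mu> (u s)"
  using decrease_by_derivative_bound[OF assms(3,2) energy_defect_derivative[OF assms(1)], of 0]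
    energy_defect_rate_nonpos by simp

text \<open>With \<open>r\<close> the radius of \<open>z\<close> and \<open>\<rho>\<close> that of the attractor, \<open>(r - \<rho>)\<^sup>2 \<le> \<bar>r - \<rho>\<bar> (r + \<rho>) = \<bar>r\<^sup>2 - \<rho>\<^sup>2\<bar>\<close>.
  The square on the left cannot be avoided in a bound that also covers \<open>\<rho> = 0\<close>.\<close>

lemma infdist_le_energy_defect:
  "(infdist z (sphere 0 (sqrt (max \<mu> 0))))\<^sup>2 \<le> sqrt (energy_defect \<mu> z)"
proof -
  define \<rho> where "\<rho> = sqrt (max \<mu> 0)"
  have \<rho>: "\<rho> \<ge> 0" "max \<mu> 0 = \<rho>\<^sup>2" by (auto simp: \<rho>_def)
  have "(norm z - \<rho>)\<^sup>2 = \<bar>norm z - \<rho>\<bar> * \<bar>norm z - \<rho>\<bar>" by (simp add: power2_eq_square)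
  also have "\<dots> \<le> \<bar>norm z - \<rho>\<bar> * (norm z + \<rho>)"
    using \<rho>(1) norm_ge_zero[of z] by (intro mult_left_mono) linarith+
  also have "\<dots> = \<bar>(norm z - \<rho>) * (norm z + \<rho>)\<bar>" using \<rho>(1) by (simp add: abs_mult)
  also have "\<dots> = \<bar>(norm z)\<^sup>2 - \<rho>\<^sup>2\<bar>" by (simp add: algebra_simps power2_eq_square)
  finally show ?thesis
    using \<rho>(1) unfolding \<rho>_def[symmetric] by (simp add: infdist_sphere_0 energy_defect_def \<rho>(2))
qed

lemma energy_defect_le_infdist:
  assumes "infdist z (sphere 0 (sqrt (max \<mu> 0))) \<le> \<delta>"
  shows "sqrt (energy_defect \<mu> z) \<le> \<delta> * (\<delta> + 2 * sqrt (max \<mu> 0))"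
proof -
  define \<rho> where "\<rho> = sqrt (max \<mu> 0)"
  have \<rho>: "\<rho> \<ge> 0" "max \<mu> 0 = \<rho>\<^sup>2" by (auto simp: \<rho>_def)
  have d: "\<bar>norm z - \<rho>\<bar> \<le> \<delta>" using assms \<rho>(1) by (simp add: infdist_sphere_0 \<rho>_def)
  have "sqrt (energy_defect \<mu> z) = \<bar>norm z - \<rho>\<bar> * (norm z + \<rho>)"
    using \<rho>(1) by (simp add: energy_defect_def \<rho>(2) power2_eq_square square_diff_square_factored abs_mult)
  also have "\<dots> \<le> \<delta> * (\<delta> + 2 * \<rho>)"
    using d \<rho>(1) by (intro mult_mono) auto
  finally show ?thesis by (simp add: \<rho>_def)
qed

text \<open>The Lyapunov function does not increase, and it bounds the distance to the attractor and is bounded by it.\<close>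

lemma stable_sphere: "stable_set (sync_field \<omega> \<mu>) (sphere 0 (sqrt (max \<mu> 0)))"
  unfolding stable_set_def
proof (intro allI impI)
  fix \<epsilon> :: real assume \<epsilon>: "\<epsilon> > 0"
  let ?S = "sphere (0 :: real \<times> real) (sqrt (max \<mu> 0))"
  let ?C = "2 + 2 * sqrt (max \<mu> 0)"
  define \<delta> where "\<delta> = min 1 (\<epsilon>\<^sup>2 / ?C)"
  have C: "?C > 0" by (rule add_pos_nonneg) auto
  have \<delta>: "\<delta> > 0" "\<delta> \<le> 1" "\<delta> * ?C \<le> \<epsilon>\<^sup>2"
    using \<epsilon> C mult_right_mono[of \<delta> "\<epsilon>\<^sup>2 / ?C" ?C] by (simp_all add: \<delta>_def)
  have bound: "\<delta> * (\<delta> + 2 * sqrt (max \<mu> 0)) < \<epsilon>\<^sup>2"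
  proof -
    have "\<delta> * (\<delta> + 2 * sqrt (max \<mu> 0)) < \<delta> * ?C" using \<delta> by (intro mult_strict_left_mono) auto
    then show ?thesis using \<delta>(3) by linarith
  qed
  have "infdist (u t) ?S < \<epsilon>"
    if u: "solution_on (sync_field \<omega> \<mu>) {0..T} u" "infdist (u 0) ?S < \<delta>" and t: "t \<in> {0..T}" for T t u
  proof -
    have "(infdist (u t) ?S)\<^sup>2 \<le> sqrt (energy_defect \<mu> (u t))" by (rule infdist_le_energy_defect)
    also have "\<dots> \<le> sqrt (energy_defect \<mu> (u 0))"
      using t by (intro real_sqrt_le_mono energy_defect_antimono[OF u(1)]) auto
    also have "\<dots> \<le> \<delta> * (\<delta> + 2 * sqrt (max \<mu> 0))"
      using u(2) by (intro energy_defect_le_infdist) auto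
    also note bound
    finally show ?thesis using \<epsilon> by (simp add: power_less_imp_less_base)
  qed
  with \<delta>(1) show "\<exists>\<delta>>0. \<forall>T\<ge>0. \<forall>u. solution_on (sync_field \<omega> \<mu>) {0..T} u \<and> infdist (u 0) ?S < \<delta> \<longrightarrow>
      (\<forall>t\<in>{0..T}. infdist (u t) ?S < \<epsilon>)" by blast
qed

text \<open>The rate of decrease is at least \<open>4 V\<close> times the Lyapunov function, so it only remains to keep the squared radius \<open>V\<close>
  away from \<open>0\<close>. For \<open>\<mu> > 0\<close> this holds for starting points near the circle, because \<open>\<bar>V - \<mu>\<bar>\<close> does not
  increase. For \<open>\<mu> \<le> 0\<close> the Lyapunov function is \<open>V\<^sup>2\<close> itself, so it is bounded away from \<open>0\<close> exactly
  when \<open>V\<close> is.\<close>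

lemma asymptotically_stable_sphere:
  "asymptotically_stable_set (sync_field \<omega> \<mu>) (sphere 0 (sqrt (max \<mu> 0)))"
  unfolding asymptotically_stable_set_def
proof (intro conjI stable_sphere)
  let ?S = "sphere (0 :: real \<times> real) (sqrt (max \<mu> 0))"
  \<comment> \<open>With \<open>\<delta> = sqrt \<mu> / 5\<close>, the bound \<open>\<delta> (\<delta> + 2 sqrt \<mu>) = 11/25 \<mu>\<close> on \<open>\<bar>V - \<mu>\<bar>\<close> is below \<open>\<mu> / 2\<close>.\<close>
  define \<delta> where "\<delta> = (if \<mu> > 0 then sqrt \<mu> / 5 else 1)"
  have \<delta>: "\<delta> > 0" by (simp add: \<delta>_def)
  have "((\<lambda>t. infdist (u t) ?S) \<longlongrightarrow> 0) at_top"
    if u: "solution_on (sync_field \<omega> \<mu>) {0..} u" and start: "infdist (u 0) ?S < \<delta>" for u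
  proof -
    have decay: "\<exists>k>0. \<forall>t\<ge>0. energy_defect \<mu> (u t) \<ge> e \<longrightarrow> energy_defect_rate \<mu> (u t) \<le> - k"
      if e: "e > 0" for e
    proof -
      define v where "v = (if \<mu> > 0 then \<mu> / 2 else sqrt e)"
      have v: "v > 0" using e by (simp add: v_def)
      have low: "(norm (u t))\<^sup>2 \<ge> v" if t: "t \<ge> 0" "energy_defect \<mu> (u t) \<ge> e" for t
      proof (cases "\<mu> > 0")
        case True
        have "\<bar>(norm (u t))\<^sup>2 - \<mu>\<bar> = sqrt (energy_defect \<mu> (u t))"
          using True by (simp add: energy_defect_def)
        also have "\<dots> \<le> sqrt (energy_defect \<mu> (u 0))"
          using t by (intro real_sqrt_le_mono energy_defect_antimono[OF u]) auto
        also have "\<dots> \<le> \<delta> * (\<delta> + 2 * sqrt (max \<mu> 0))"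
          using start by (intro energy_defect_le_infdist) auto
        also have "\<dots> = 11 / 25 * \<mu>" using True by (simp add: \<delta>_def field_simps)
        finally have "\<mu> - (norm (u t))\<^sup>2 \<le> 11 / 25 * \<mu>" by linarith
        then show ?thesis using True by (simp add: v_def)
      next
        case False
        have "sqrt e \<le> sqrt (energy_defect \<mu> (u t))" using t by simp
        also have "\<dots> = (norm (u t))\<^sup>2"
          unfolding energy_defect_def real_sqrt_abs using False by simp
        finally show ?thesis using False by (simp add: v_def)
      qed
      have "energy_defect_rate \<mu> (u t) \<le> - (4 * v * e)" if t: "t \<ge> 0" "energy_defect \<mu> (u t) \<ge> e" for t
      proof -
        have "v * e \<le> (norm (u t))\<^sup>2 * energy_defect \<mu> (u t)"
          using low[OF t] t(2) v e by (intro mult_mono) auto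
        then show ?thesis using energy_defect_rate_le[of \<mu> "u t"] by simp
      qed
      then show ?thesis using v e by (intro exI[of _ "4 * v * e"]) simp
    qed
    have "((\<lambda>t. energy_defect \<mu> (u t)) \<longlongrightarrow> 0) at_top"
      using energy_defect_derivative[OF u] energy_defect_rate_nonpos decay
      by (intro tendsto_0_of_strict_decay[of _ "\<lambda>t. energy_defect_rate \<mu> (u t)"])
         (auto simp: energy_defect_def)
    then have "((\<lambda>t. sqrt (sqrt (energy_defect \<mu> (u t)))) \<longlongrightarrow> 0) at_top"
      using tendsto_real_sqrt[OF tendsto_real_sqrt] by fastforce
    moreover have "infdist (u t) ?S \<le> sqrt (sqrt (energy_defect \<mu> (u t)))" for t
      using infdist_le_energy_defect[of "u t" \<mu>] by (rule real_le_rsqrt)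
    ultimately show ?thesis
      by (intro tendsto_sandwich[of "\<lambda>_. 0" "\<lambda>t. infdist (u t) ?S" at_top])
         (auto simp: infdist_nonneg)
  qed
  with \<delta> show "\<exists>\<delta>>0. \<forall>u. solution_on (sync_field \<omega> \<mu>) {0..} u \<and> infdist (u 0) ?S < \<delta> \<longrightarrow>
      ((\<lambda>t. infdist (u t) ?S) \<longlongrightarrow> 0) at_top" by blast
qed

section \<open>Instability of the origin and periodic orbits\<close>

text \<open>The logistic equation \<open>g' = 2 g (\<mu> - g)\<close> for the squared radius is solved by \<open>g t = \<mu> / (1 + exp (2 \<mu> (T - t)))\<close>,
  shifted so that \<open>g T = \<mu> / 2\<close>. The solution spiralling out along \<open>g\<close> starts as close to the origin as desired
  when \<open>T\<close> is large, yet always reaches radius \<open>sqrt (\<mu> / 2)\<close>.\<close>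

lemma unstable_origin:
  assumes \<mu>: "\<mu> > 0"
  shows "\<not> stable_set (sync_field \<omega> \<mu>) {0}"
proof
  assume stable_0: "stable_set (sync_field \<omega> \<mu>) {0}"
  have "sqrt (\<mu> / 2) > 0" using \<mu> by simp
  from stable_0[unfolded stable_set_def, rule_format, OF this]
  obtain \<delta> where \<delta>: "\<delta> > 0" and
    near: "\<forall>T\<ge>0. \<forall>u. solution_on (sync_field \<omega> \<mu>) {0..T} u \<and> infdist (u 0) {0} < \<delta> \<longrightarrow>
      (\<forall>t\<in>{0..T}. infdist (u t) {0} < sqrt (\<mu> / 2))" by blast
  have stable: "norm (u t) < sqrt (\<mu> / 2)"
    if "T \<ge> 0" "solution_on (sync_field \<omega> \<mu>) {0..T} u" "norm (u 0) < \<delta>" "t \<in> {0..T}" for T u t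
    using near[rule_format, OF that(1) conjI[OF that(2)]] that(3,4) by simp
  \<comment> \<open>Chosen so that \<open>g 0 \<le> \<mu> / (2 \<mu> T) = \<delta>\<^sup>2 / 2\<close>, where the exponential is bounded below by its linear part.\<close>
  define T where "T = 1 / \<delta>\<^sup>2"
  have T: "T > 0" using \<delta> by (simp add: T_def)
  define g where "g t = \<mu> / (1 + exp (2 * \<mu> * (T - t)))" for t
  have g_pos: "g t > 0" for t using \<mu> by (simp add: g_def add_pos_pos)
  have g': "(g has_real_derivative 2 * g t * (\<mu> - g t)) (at t within I)" for t I
  proof -
    define E where "E = exp (2 * \<mu> * (T - t))"
    have E: "1 + E \<noteq> 0" "1 + exp (2 * \<mu> * (T - t)) \<noteq> 0"
      using exp_gt_zero[of "2 * \<mu> * (T - t)"] by (simp_all add: E_def add_pos_pos less_imp_neq[symmetric])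
    have *: "\<mu> - \<mu> / (1 + E) = \<mu> * E / (1 + E)"
      using E(1) by (simp add: field_simps)
    show ?thesis unfolding g_def
      by (rule derivative_eq_intros refl E(2))+ (simp add: E_def[symmetric] *)
  qed
  define u where "u t = (sqrt (g t) * cos (\<omega> * t), sqrt (g t) * sin (\<omega> * t))" for t
  have norm_u: "norm (u t) = sqrt (g t)" for t
  proof -
    have "(norm (u t))\<^sup>2 = g t * ((cos (\<omega> * t))\<^sup>2 + (sin (\<omega> * t))\<^sup>2)"
      unfolding norm_square_pair
      by (simp only: u_def fst_conv snd_conv power_mult_distrib
          real_sqrt_pow2[OF less_imp_le[OF g_pos]] distrib_left)
    then have "(norm (u t))\<^sup>2 = g t" by simp
    then show ?thesis by (metis norm_ge_zero real_sqrt_unique)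
  qed
  have r': "((\<lambda>t. sqrt (g t)) has_real_derivative sqrt (g t) * (\<mu> - g t)) (at t within I)" for t I
  proof -
    have "((\<lambda>t. sqrt (g t)) has_real_derivative
        inverse (sqrt (g t)) / 2 * (2 * g t * (\<mu> - g t))) (at t within I)"
      by (rule DERIV_chain2[of sqrt _ g, OF DERIV_real_sqrt[OF g_pos] g'])
    moreover have "inverse s / 2 * (2 * b * m) = b / s * m" for s b m :: real
      by (simp add: field_simps)
    then have "inverse (sqrt (g t)) / 2 * (2 * g t * (\<mu> - g t)) = g t / sqrt (g t) * (\<mu> - g t)"
      .
    moreover have "g t / sqrt (g t) = sqrt (g t)" using g_pos[of t] by (simp add: real_div_sqrt)
    ultimately show ?thesis by (simp only:)
  qed
  have sq: "(sqrt (g t) * cos (\<omega> * t))\<^sup>2 + (sqrt (g t) * sin (\<omega> * t))\<^sup>2 = g t" for t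
  proof -
    have "(fst (u t))\<^sup>2 + (snd (u t))\<^sup>2 = g t"
      using norm_square_pair[of "u t"] g_pos[of t] by (simp add: norm_u less_imp_le)
    then show ?thesis by (simp only: u_def fst_conv snd_conv)
  qed
  have "solution_on (sync_field \<omega> \<mu>) {0..T} u"
    unfolding u_def
  proof (rule solution_onI_components, unfold sync_field_def prod.case fst_conv snd_conv sq)
    show "((\<lambda>t. sqrt (g t) * cos (\<omega> * t)) has_real_derivative \<mu> * (sqrt (g t) * cos (\<omega> * t))
        - \<omega> * (sqrt (g t) * sin (\<omega> * t)) - sqrt (g t) * cos (\<omega> * t) * g t) (at t within {0..T})" for t
      by (rule DERIV_cong[OF DERIV_mult[OF r' DERIV_chain2[OF DERIV_cos DERIV_cmult_Id]]])
        (simp add: algebra_simps)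
    show "((\<lambda>t. sqrt (g t) * sin (\<omega> * t)) has_real_derivative \<omega> * (sqrt (g t) * cos (\<omega> * t))
        + \<mu> * (sqrt (g t) * sin (\<omega> * t)) - sqrt (g t) * sin (\<omega> * t) * g t) (at t within {0..T})" for t
      by (rule DERIV_cong[OF DERIV_mult[OF r' DERIV_chain2[OF DERIV_sin DERIV_cmult_Id]]])
        (simp add: algebra_simps)
  qed
  moreover have "norm (u 0) < \<delta>"
  proof -
    have "2 * \<mu> * T \<le> 1 + exp (2 * \<mu> * T)"
      using exp_ge_add_one_self[of "2 * \<mu> * T"] by linarith
    then have "g 0 \<le> \<mu> / (2 * \<mu> * T)"
      using \<mu> T
      unfolding g_def by (intro divide_left_mono) (auto intro!: mult_pos_pos add_pos_pos)
    also have "\<dots> = \<delta>\<^sup>2 / 2" using \<mu> \<delta> by (simp add: T_def)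
    also have "\<dots> < \<delta>\<^sup>2" using \<delta> by simp
    finally show ?thesis using \<delta> by (simp add: norm_u real_less_lsqrt)
  qed
  ultimately have "norm (u T) < sqrt (\<mu> / 2)" using stable[of T u T] T by auto
  moreover have "g T = \<mu> / 2" by (simp add: g_def)
  ultimately show False by (simp add: norm_u)
qed

text \<open>The curve is \<open>(p + \<i>q) exp (\<i>\<omega>t)\<close> in complex notation. A point \<open>a + \<i>b\<close> of the same modulus is reached at the
  angle of the quotient \<open>(a + \<i>b) / (p + \<i>q)\<close>, unless both vanish.\<close>

lemma range_rotation:
  fixes p q \<omega> :: real
  assumes "\<omega> \<noteq> 0"
  shows "range (\<lambda>t. (p * cos (\<omega> * t) - q * sin (\<omega> * t), p * sin (\<omega> * t) + q * cos (\<omega> * t)))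
    = sphere 0 (sqrt (p\<^sup>2 + q\<^sup>2))" (is "range ?u = _")
proof (intro equalityI subsetI)
  fix z assume "z \<in> range ?u"
  then obtain t where z: "z = ?u t" by auto
  have "(p * cos (\<omega> * t) - q * sin (\<omega> * t))\<^sup>2 + (p * sin (\<omega> * t) + q * cos (\<omega> * t))\<^sup>2
      = (p\<^sup>2 + q\<^sup>2) * ((sin (\<omega> * t))\<^sup>2 + (cos (\<omega> * t))\<^sup>2)"
    by (simp only: power2_eq_square) (simp only: algebra_simps)
  then show "z \<in> sphere 0 (sqrt (p\<^sup>2 + q\<^sup>2))" by (simp add: z norm_prod_def)
next
  fix z :: "real \<times> real" assume z: "z \<in> sphere 0 (sqrt (p\<^sup>2 + q\<^sup>2))"
  obtain a b where ab: "z = (a, b)" by (cases z)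
  define m where "m = p\<^sup>2 + q\<^sup>2"
  have m: "a\<^sup>2 + b\<^sup>2 = m" using z by (simp add: ab norm_prod_def m_def)
  show "z \<in> range ?u"
  proof (cases "m = 0")
    case True
    then have "p = 0" "q = 0" "a = 0" "b = 0" using m by (auto simp: m_def sum_power2_eq_zero_iff)
    then show ?thesis by (auto simp: ab)
  next
    case False
    have "((a * p + b * q) / m)\<^sup>2 + ((b * p - a * q) / m)\<^sup>2 = ((a\<^sup>2 + b\<^sup>2) * (p\<^sup>2 + q\<^sup>2)) / m\<^sup>2"
      by (simp add: power_divide flip: add_divide_distrib) (simp add: power2_eq_square algebra_simps)
    also have "\<dots> = 1" unfolding m m_def[symmetric] using False by (simp add: power2_eq_square)
    finally obtain \<phi> where \<phi>: "(a * p + b * q) / m = cos \<phi>" "(b * p - a * q) / m = sin \<phi>"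
      using sincos_total_2pi by metis
    have "p * cos \<phi> - q * sin \<phi> = a * m / m"
      unfolding \<phi>[symmetric] times_divide_eq_right diff_divide_distrib[symmetric] m_def
      by (simp add: power2_eq_square algebra_simps)
    moreover have "p * sin \<phi> + q * cos \<phi> = b * m / m"
      unfolding \<phi>[symmetric] times_divide_eq_right add_divide_distrib[symmetric] m_def
      by (simp add: power2_eq_square algebra_simps)
    ultimately have "z = ?u (\<phi> / \<omega>)" using False assms by (simp add: ab)
    then show ?thesis by blast
  qed
qed

text \<open>On the circle of squared radius \<open>\<mu>\<close> the linear growth and the cubic damping cancel, which leaves a pure rotation.
  In the rotating frame the solution is therefore constant.\<close>

lemma solution_on_circle_is_rotation:
  assumes u: "solution_on (sync_field \<omega> \<mu>) UNIV u" and V: "\<And>t. (norm (u t))\<^sup>2 = \<mu>"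
  obtains p q where "\<And>t. u t = (p * cos (\<omega> * t) - q * sin (\<omega> * t), p * sin (\<omega> * t) + q * cos (\<omega> * t))"
proof -
  let ?c = "\<lambda>t. cos (\<omega> * t)" and ?s = "\<lambda>t. sin (\<omega> * t)"
  \<comment> \<open>The coordinates in the rotating frame.\<close>
  define P where "P t = fst (u t) * ?c t + snd (u t) * ?s t" for t
  define Q where "Q t = snd (u t) * ?c t - fst (u t) * ?s t" for t
  have d: "((\<lambda>t. fst (u t)) has_real_derivative - \<omega> * snd (u t)) (at t)"
    "((\<lambda>t. snd (u t)) has_real_derivative \<omega> * fst (u t)) (at t)" for t
    using solution_on_sync_field_components[OF u, of t] by (simp_all add: V)
  have "(P has_real_derivative 0) (at t)" "(Q has_real_derivative 0) (at t)" for t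
    unfolding P_def Q_def
    by ((rule derivative_eq_intros d refl)+; simp add: algebra_simps)+
  then have const: "P t = P 0" "Q t = Q 0" for t
    using DERIV_isconst_all[of P t 0] DERIV_isconst_all[of Q t 0] by auto
  have "u t = (P 0 * ?c t - Q 0 * ?s t, P 0 * ?s t + Q 0 * ?c t)" for t
  proof -
    have "(x * k + y * l) * k - (y * k - x * l) * l = x * (l\<^sup>2 + k\<^sup>2)"
      "(x * k + y * l) * l + (y * k - x * l) * k = y * (l\<^sup>2 + k\<^sup>2)" for x y k l :: real
      by (simp_all add: algebra_simps power2_eq_square)
    then have "P t * ?c t - Q t * ?s t = fst (u t)" "P t * ?s t + Q t * ?c t = snd (u t)"
      by (simp_all only: P_def Q_def sin_cos_squared_add mult_1_right)
    then show ?thesis by (simp add: const[of t] prod_eq_iff)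
  qed
  then show ?thesis by (rule that)
qed

text \<open>A differentiable function that is periodic and nowhere increasing must be constant.\<close>

lemma periodic_solution_energy_defect:
  assumes u: "solution_on (sync_field \<omega> \<mu>) UNIV u" and T: "T > 0" and per: "\<And>t. u (t + T) = u t"
  shows "energy_defect_rate \<mu> (u t) = 0" and "energy_defect \<mu> (u t) = energy_defect \<mu> (u 0)"
proof -
  note d = energy_defect_derivative[OF u UNIV_I]
  show zero: "energy_defect_rate \<mu> (u t) = 0" for t
  proof (rule ccontr)
    assume "energy_defect_rate \<mu> (u t) \<noteq> 0"
    then have "energy_defect_rate \<mu> (u t) < 0" using energy_defect_rate_nonpos[of \<mu> "u t"] by simp
    from DERIV_neg_dec_right[OF d this] obtain h where h: "h > 0"
      "\<And>s. 0 < s \<Longrightarrow> s < h \<Longrightarrow> energy_defect \<mu> (u (t + s)) < energy_defect \<mu> (u t)" by blast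
    define s where "s = min (h / 2) T"
    have s: "0 < s" "s < h" "s \<le> T" using h(1) T by (auto simp: s_def)
    have "energy_defect \<mu> (u (t + T)) \<le> energy_defect \<mu> (u (t + s))"
      using s by (intro energy_defect_antimono[OF u]) auto
    also have "\<dots> < energy_defect \<mu> (u t)" using h(2) s by auto
    finally show False by (simp add: per)
  qed
  show "energy_defect \<mu> (u t) = energy_defect \<mu> (u 0)"
    using DERIV_isconst_all[of "\<lambda>t. energy_defect \<mu> (u t)" t 0] d by (simp add: zero)
qed

text \<open>Along a periodic orbit the Lyapunov function is constant, so its rate vanishes, and at every time the
  solution is at the origin or on the attractor. A constant positive value of the Lyapunov function forces the constant solution \<open>0\<close>; the
  value \<open>0\<close> leaves only the attractor, which for \<open>\<mu> \<le> 0\<close> is a single point.\<close>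

lemma periodic_orbit_sync_field_iff:
  assumes \<omega>: "\<omega> \<noteq> 0"
  shows "periodic_orbit (sync_field \<omega> \<mu>) C \<longleftrightarrow> \<mu> > 0 \<and> C = sphere 0 (sqrt \<mu>)"
proof
  assume "periodic_orbit (sync_field \<omega> \<mu>) C"
  then obtain u T t\<^sub>0 where u: "solution_on (sync_field \<omega> \<mu>) UNIV u" and T: "T > 0"
    and per: "\<And>t. u (t + T) = u t" and nonconst: "u t\<^sub>0 \<noteq> u 0" and C: "C = range u"
    unfolding periodic_orbit_def by auto
  note E = periodic_solution_energy_defect[OF u T per]
  have VW: "norm (u t) = 0 \<or> energy_defect \<mu> (u t) = 0" for t
  proof -
    have "(norm (u t))\<^sup>2 * energy_defect \<mu> (u t) \<ge> 0" by (simp add: energy_defect_def)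
    then have "(norm (u t))\<^sup>2 * energy_defect \<mu> (u t) = 0"
      using energy_defect_rate_le[of \<mu> "u t"] E(1)[of t] by linarith
    then show ?thesis by simp
  qed
  have "energy_defect \<mu> (u 0) = 0"
  proof (rule ccontr)
    assume "energy_defect \<mu> (u 0) \<noteq> 0"
    then have "u t = 0" for t using VW[of t] E(2)[of t] by simp
    then show False using nonconst by simp
  qed
  then have V: "(norm (u t))\<^sup>2 = max \<mu> 0" for t
    using E(2)[of t] by (simp add: energy_defect_def)
  have \<mu>: "\<mu> > 0"
  proof (rule ccontr)
    assume "\<not> \<mu> > 0"
    then have "u t = 0" for t using V[of t] by (simp add: max_def split: if_splits)
    then show False using nonconst by simp
  qed
  then obtain p q where
    pq: "\<And>t. u t = (p * cos (\<omega> * t) - q * sin (\<omega> * t), p * sin (\<omega> * t) + q * cos (\<omega> * t))"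
    using solution_on_circle_is_rotation[OF u] V by auto
  have "p\<^sup>2 + q\<^sup>2 = \<mu>" using V[of 0] \<mu> unfolding norm_square_pair by (simp add: pq)
  moreover have "u = (\<lambda>t. (p * cos (\<omega> * t) - q * sin (\<omega> * t), p * sin (\<omega> * t) + q * cos (\<omega> * t)))"
    using pq by blast
  ultimately have "C = sphere 0 (sqrt \<mu>)" using range_rotation[OF \<omega>, of p q] C by metis
  with \<mu> show "\<mu> > 0 \<and> C = sphere 0 (sqrt \<mu>)" ..
next
  assume *: "\<mu> > 0 \<and> C = sphere 0 (sqrt \<mu>)"
  define r where "r = sqrt \<mu>"
  have r: "r > 0" "r\<^sup>2 = \<mu>" "C = sphere 0 r" using * by (auto simp: r_def)
  define u where "u t = (r * cos (\<omega> * t), r * sin (\<omega> * t))" for t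
  have sq: "(r * cos (\<omega> * t))\<^sup>2 + (r * sin (\<omega> * t))\<^sup>2 = \<mu>" for t
    unfolding power_mult_distrib distrib_left[symmetric] by (simp add: r(2))
  have "solution_on (sync_field \<omega> \<mu>) UNIV u"
    unfolding u_def
  proof (rule solution_onI_components, unfold sync_field_def prod.case fst_conv snd_conv sq)
    show "((\<lambda>t. r * cos (\<omega> * t)) has_real_derivative
        \<mu> * (r * cos (\<omega> * t)) - \<omega> * (r * sin (\<omega> * t)) - r * cos (\<omega> * t) * \<mu>) (at t)" for t
      by (rule derivative_eq_intros refl)+ simp
    show "((\<lambda>t. r * sin (\<omega> * t)) has_real_derivative
        \<omega> * (r * cos (\<omega> * t)) + \<mu> * (r * sin (\<omega> * t)) - r * sin (\<omega> * t) * \<mu>) (at t)" for t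
      by (rule derivative_eq_intros refl)+ simp
  qed
  moreover have "u (t + 2 * pi / \<bar>\<omega>\<bar>) = u t" for t
  proof (cases "\<omega> > 0")
    case True
    then have "\<omega> * (t + 2 * pi / \<bar>\<omega>\<bar>) = \<omega> * t + 2 * pi" by (simp add: distrib_left)
    then show ?thesis by (simp add: u_def)
  next
    case False
    then have "\<omega> * (t + 2 * pi / \<bar>\<omega>\<bar>) = \<omega> * t - 2 * pi" using \<omega> by (simp add: right_diff_distrib)
    then show ?thesis by (simp add: u_def cos_diff sin_diff)
  qed
  moreover have "u (pi / \<omega>) \<noteq> u 0" using \<omega> r(1) by (simp add: u_def)
  moreover have "C = range u"
    using range_rotation[OF \<omega>, of r 0] r(1) by (simp add: u_def[abs_def] r(3))
  moreover have "2 * pi / \<bar>\<omega>\<bar> > 0" using \<omega> by simp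
  ultimately show "periodic_orbit (sync_field \<omega> \<mu>) C" unfolding periodic_orbit_def by blast
qed
section \<open>The Hopf bifurcation and the critical blocks\<close>

lemma planar_jacobian_sync_field:
  "planar_jacobian (sync_field \<omega> \<mu>) 0 = conformal_mat (of_real \<mu>) (of_real \<omega>)"
proof -
  have "deriv (\<lambda>t. \<mu> * t - \<omega> * 0 - t * (t\<^sup>2 + 0\<^sup>2)) 0 = \<mu>"
    "deriv (\<lambda>t. \<mu> * 0 - \<omega> * t - 0 * (0\<^sup>2 + t\<^sup>2)) 0 = - \<omega>"
    "deriv (\<lambda>t. \<omega> * t + \<mu> * 0 - 0 * (t\<^sup>2 + 0\<^sup>2)) 0 = \<omega>"
    "deriv (\<lambda>t. \<omega> * 0 + \<mu> * t - t * (0\<^sup>2 + t\<^sup>2)) 0 = \<mu>"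
    by (rule DERIV_imp_deriv; auto intro!: derivative_eq_intros)+
  then show ?thesis
    by (intro eq_mat_2I)
      (simp_all add: planar_jacobian_def jacobian_def sync_field_def conformal_mat_def unit_vec_def
        vec_of_list_index vec_of_list_Cons)
qed

lemma hopf_crossing_sync_field:
  assumes "\<omega> \<noteq> 0"
  shows "hopf_crossing (sync_field \<omega>) 0 0"
proof -
  have "spectrum (planar_jacobian (sync_field \<omega> \<mu>) 0) = {Complex \<mu> \<omega>, Complex \<mu> (- \<omega>)}" for \<mu>
    unfolding planar_jacobian_sync_field spectrum_conformal_mat
    by (intro arg_cong2[where f = insert] refl) (simp_all add: complex_eq_iff)
  moreover have "((\<lambda>\<mu>. \<mu>) has_real_derivative 1) (at (0 :: real))"
    by (rule DERIV_ident)
  moreover have "sync_field \<omega> \<mu> 0 = 0" for \<mu>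
    by (simp add: sync_field_def zero_prod_def)
  ultimately show ?thesis
    unfolding hopf_crossing_def using assms
    by (intro conjI exI[of _ "\<lambda>\<mu>. \<mu>"] exI[of _ "\<lambda>_. \<omega>"] exI[of _ "1 :: real"]) simp_all
qed

text \<open>The phase portrait is known for every \<open>\<mu>\<close>, so the neighbourhood of the origin and the parameter range are arbitrary up
  to one condition: the circle of radius \<open>sqrt \<mu>\<close> must fit into the neighbourhood. Radius \<open>1\<close> and
  \<open>\<mu> < 1\<close> satisfy it.\<close>

lemma supercritical_hopf_sync_field:
  assumes \<omega>: "\<omega> \<noteq> 0"
  shows "supercritical_hopf (sync_field \<omega>) 0 0"
proof -
  let ?C = "\<lambda>\<mu>. sphere (0 :: real \<times> real) (sqrt \<mu>)"
  have below: "asymptotically_stable_set (sync_field \<omega> \<mu>) {0}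
      \<and> (\<nexists>C. periodic_orbit (sync_field \<omega> \<mu>) C \<and> C \<subseteq> ball 0 1)" if "\<mu> \<in> {0 - 1<..0}" for \<mu>
  proof -
    have "sphere (0 :: real \<times> real) (sqrt (max \<mu> 0)) = {0}"
      using that by (auto simp: max_def)
    then show ?thesis
      using asymptotically_stable_sphere[of \<omega> \<mu>] that
      by (auto simp: periodic_orbit_sync_field_iff[OF \<omega>])
  qed
  have above: "\<not> stable_set (sync_field \<omega> \<mu>) {0}
      \<and> (\<forall>D. periodic_orbit (sync_field \<omega> \<mu>) D \<and> D \<subseteq> ball 0 1 \<longleftrightarrow> D = ?C \<mu>)
      \<and> asymptotically_stable_set (sync_field \<omega> \<mu>) (?C \<mu>)" if "\<mu> \<in> {0<..<0 + 1}" for \<mu>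
  proof (intro conjI)
    have "?C \<mu> \<subseteq> ball 0 1" using that by auto
    then show "\<forall>D. periodic_orbit (sync_field \<omega> \<mu>) D \<and> D \<subseteq> ball 0 1 \<longleftrightarrow> D = ?C \<mu>"
      using that by (auto simp: periodic_orbit_sync_field_iff[OF \<omega>])
    show "\<not> stable_set (sync_field \<omega> \<mu>) {0}" using that by (intro unstable_origin) simp
    show "asymptotically_stable_set (sync_field \<omega> \<mu>) (?C \<mu>)"
      using asymptotically_stable_sphere[of \<omega> \<mu>] that by (simp add: max_def)
  qed
  have shrink: "\<forall>\<^sub>F \<mu> in at_right 0. ?C \<mu> \<subseteq> ball 0 \<epsilon>" if "\<epsilon> > 0" for \<epsilon>
    unfolding eventually_at_right_field
  proof (intro exI[of _ "\<epsilon>\<^sup>2"] conjI allI impI)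
    show "\<epsilon>\<^sup>2 > 0" using that by simp
    show "?C \<mu> \<subseteq> ball 0 \<epsilon>" if "0 < \<mu>" "\<mu> < \<epsilon>\<^sup>2" for \<mu>
      using that \<open>\<epsilon> > 0\<close> by (auto simp: real_less_lsqrt)
  qed
  have "\<exists>C. (\<forall>\<mu>\<in>{0<..<0 + 1}. \<not> stable_set (sync_field \<omega> \<mu>) {0}
        \<and> (\<forall>D. periodic_orbit (sync_field \<omega> \<mu>) D \<and> D \<subseteq> ball 0 1 \<longleftrightarrow> D = C \<mu>)
        \<and> asymptotically_stable_set (sync_field \<omega> \<mu>) (C \<mu>))
      \<and> (\<forall>\<epsilon>>0. \<forall>\<^sub>F \<mu> in at_right 0. C \<mu> \<subseteq> ball 0 \<epsilon>)"
    using above shrink by (intro exI[of _ ?C] conjI ballI allI impI) simp_all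
  then show ?thesis
    unfolding supercritical_hopf_def using below
    by (intro conjI hopf_crossing_sync_field[OF \<omega>] exI[of _ "1::real"]) auto
qed

theorem proposition4p3:
  fixes N :: nat and c \<omega> :: real and a :: "nat \<Rightarrow> nat \<Rightarrow> real"
    and M :: "real \<Rightarrow> nat \<Rightarrow> complex mat"
  assumes "N \<ge> 1" and "c > 0" and "\<omega> \<noteq> 0"
    and all_to_all: "\<And>l k. l \<in> {1..N} \<Longrightarrow> k \<in> {1..N} \<Longrightarrow> a l k = (if k = l then 0 else 1)"
    and M: "\<And>\<mu> j. M \<mu> j = fourier_block N (network_jacobian N a c \<omega> \<mu>) j"
  shows "(\<forall>l\<in>{1..N}. \<forall>k\<in>{1..N}.
            a l k = ring_coupling N (if even N then N div 2 else (N - 1) div 2) l k)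
    \<and> (\<forall>\<mu>. spectrum (M \<mu> 1) = {of_real \<mu> + \<i> * of_real \<omega>, of_real \<mu> - \<i> * of_real \<omega>})
    \<and> (\<forall>\<mu>. \<forall>j\<in>{2..N}. spectrum (M \<mu> j) =
            {of_real (\<mu> - real N * c) + \<i> * of_real \<omega>, of_real (\<mu> - real N * c) - \<i> * of_real \<omega>})
    \<and> spectrum (M 0 1) = {\<i> * of_real \<omega>, - \<i> * of_real \<omega>}
    \<and> (\<forall>j\<in>{1..N}. critical (M 0 j) \<longleftrightarrow> j = 1)
    \<and> (\<forall>j\<in>{2..N}. \<forall>z\<in>spectrum (M 0 j). Re z \<noteq> 0)
    \<and> (\<forall>\<mu> z. network_field N a c \<omega> \<mu> (sync_state N z) = sync_state N (sync_field \<omega> \<mu> z))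
    \<and> (\<forall>\<mu>. similar_mat (M \<mu> 1) (planar_jacobian (sync_field \<omega> \<mu>) 0))
    \<and> supercritical_hopf (sync_field \<omega>) 0 0
    \<and> (\<forall>\<mu>. \<forall>j\<in>{2..N}. critical (M \<mu> j) \<longleftrightarrow> \<mu> = real N * c)
    \<and> (\<forall>j\<in>{2..N}. spectrum (M (real N * c) j) = {\<i> * of_real \<omega>, - \<i> * of_real \<omega>})
    \<and> card {j \<in> {1..N}. spectrum (M (real N * c) j) = {\<i> * of_real \<omega>, - \<i> * of_real \<omega>}} = N - 1"
proof -
  \<comment> \<open>The common real part of the two eigenvalues of \<open>M \<mu> j\<close>.\<close>
  let ?rate = "\<lambda>\<mu> j. if j = 1 then \<mu> else \<mu> - real N * c"
  have block: "M \<mu> j = conformal_mat (of_real (?rate \<mu> j)) (of_real (- \<omega>))"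
    if "j \<in> {1..N}" for \<mu> j
    unfolding M of_real_minus by (rule fourier_block_all_to_all[OF all_to_all that])
  have spec: "spectrum (M \<mu> j)
      = {of_real (?rate \<mu> j) + \<i> * of_real \<omega>, of_real (?rate \<mu> j) - \<i> * of_real \<omega>}"
    if "j \<in> {1..N}" for \<mu> j
    unfolding block[OF that] spectrum_conformal_mat by (simp add: insert_commute)
  have crit: "critical (M \<mu> j) \<longleftrightarrow> ?rate \<mu> j = 0" if "j \<in> {1..N}" for \<mu> j
    unfolding block[OF that] using \<open>\<omega> \<noteq> 0\<close> by (intro critical_conformal_mat) simp
  have one: "1 \<in> {1..N}" and tail: "\<And>j. j \<in> {2..N} \<Longrightarrow> j \<in> {1..N} \<and> j \<noteq> 1"
    using \<open>N \<ge> 1\<close> by auto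
  have spec_Nc: "spectrum (M (real N * c) j) = {\<i> * of_real \<omega>, - \<i> * of_real \<omega>}"
    if "j \<in> {2..N}" for j
    using tail[OF that] spec[of j "real N * c"] by simp
  have sync_Nc: "spectrum (M (real N * c) 1) \<noteq> {\<i> * of_real \<omega>, - \<i> * of_real \<omega>}"
  proof
    assume "spectrum (M (real N * c) 1) = {\<i> * of_real \<omega>, - \<i> * of_real \<omega>}"
    then have "of_real (real N * c) + \<i> * of_real \<omega> \<in> {\<i> * complex_of_real \<omega>, - \<i> * of_real \<omega>}"
      using spec[OF one, of "real N * c"] by auto
    moreover have "Re z = 0" if "z \<in> {\<i> * complex_of_real \<omega>, - \<i> * of_real \<omega>}" for z
      using that by auto
    ultimately have "Re (of_real (real N * c) + \<i> * of_real \<omega>) = 0" by blast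
    then show False using \<open>N \<ge> 1\<close> \<open>c > 0\<close> by simp
  qed
  have "{j \<in> {1..N}. spectrum (M (real N * c) j) = {\<i> * of_real \<omega>, - \<i> * of_real \<omega>}} = {2..N}"
    (is "?crit = _")
  proof (intro equalityI subsetI)
    fix j assume j: "j \<in> ?crit"
    then have "j \<noteq> 1" using sync_Nc by blast
    with j show "j \<in> {2..N}" by auto
  qed (use spec_Nc tail in blast)
  then have card: "card {j \<in> {1..N}. spectrum (M (real N * c) j)
      = {\<i> * of_real \<omega>, - \<i> * of_real \<omega>}} = N - 1" by simp
  have similar: "similar_mat (M \<mu> 1) (planar_jacobian (sync_field \<omega> \<mu>) 0)" for \<mu>
    using similar_conformal_mat_uminus[of "of_real \<mu>" "of_real \<omega>"]
    unfolding block[OF one] planar_jacobian_sync_field by simp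
  show ?thesis
  proof (intro conjI ballI allI)
    show "a l k = ring_coupling N (if even N then N div 2 else (N - 1) div 2) l k"
      if "l \<in> {1..N}" "k \<in> {1..N}" for l k
      using all_to_all[OF that] ring_coupling_all_to_all[OF that] by simp
    show "spectrum (M \<mu> 1) = {of_real \<mu> + \<i> * of_real \<omega>, of_real \<mu> - \<i> * of_real \<omega>}" for \<mu>
      using spec[OF one] by simp
    show "spectrum (M \<mu> j) = {of_real (\<mu> - real N * c) + \<i> * of_real \<omega>,
        of_real (\<mu> - real N * c) - \<i> * of_real \<omega>}" if "j \<in> {2..N}" for \<mu> j
      using spec tail[OF that] by simp
    show "spectrum (M 0 1) = {\<i> * of_real \<omega>, - \<i> * of_real \<omega>}"
      using spec[OF one, of 0] by simp
    show "critical (M 0 j) \<longleftrightarrow> j = 1" if "j \<in> {1..N}" for j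
      using crit[OF that, of 0] \<open>N \<ge> 1\<close> \<open>c > 0\<close> by auto
    show "Re z \<noteq> 0" if "j \<in> {2..N}" "z \<in> spectrum (M 0 j)" for j z
      using spec[of j 0] tail[OF that(1)] that(2) \<open>N \<ge> 1\<close> \<open>c > 0\<close> by auto
    show "network_field N a c \<omega> \<mu> (sync_state N z) = sync_state N (sync_field \<omega> \<mu> z)" for \<mu> z
      by (rule network_field_sync_state)
    show "similar_mat (M \<mu> 1) (planar_jacobian (sync_field \<omega> \<mu>) 0)" for \<mu>
      by (rule similar)
    show "supercritical_hopf (sync_field \<omega>) 0 0"
      by (rule supercritical_hopf_sync_field[OF \<open>\<omega> \<noteq> 0\<close>])
    show "critical (M \<mu> j) \<longleftrightarrow> \<mu> = real N * c" if "j \<in> {2..N}" for \<mu> j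
      using crit[of j \<mu>] tail[OF that] by simp
    show "spectrum (M (real N * c) j) = {\<i> * of_real \<omega>, - \<i> * of_real \<omega>}" if "j \<in> {2..N}" for j
      by (rule spec_Nc[OF that])
  qed (rule card)
qed

end
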